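(* Let $\mathbf{V}$ be a valuation domain with residue field $\mathbf{k}$. The saturation algorithm (described in the context) computes, from a matrix $F$ with coefficients in $\mathbf{V}$, a matrix $G$ with coefficients in $\mathbf{V}$ that is in strict $\mathbf{k}$-echelon form and such that $\operatorname{Im}(G)=\operatorname{Sat}(\operatorname{Im}(F))$. Moreover, this algorithm is incremental in the following sense: if it is applied to a matrix $[\,F_1\mid F_2\,]$, one obtains a matrix $[\,G_1\mid G_2\,]$ where $G_1$ is the matrix obtained by applying it to $F_1$.
   Context: A valuation domain is an integral domain $\mathbf{V}$ such that for all $a,b\in\mathbf{V}$ either $a\mid b$ or $b\mid a$; it is a local ring, with residue field $\mathbf{k}=\mathbf{V}/\operatorname{Rad}(\mathbf{V})$, $\operatorname{Rad}(\mathbf V)$ being the maximal ideal. (Constructively, one assumes that the divisibility disjunction is decided by an algorithm which also produces the quotient, that equality to $0$ is decidable, and that one can decide whether an element is a unit; classically these hold for every valuation domain.) The rows of matrices are indexed by a finite totally ordered set $I$, and columns are vectors of $\mathbf{V}^{I}$ with natural basis $(e_i)_{i\in I}$. $\operatorname{Im}(F)$ is the $\mathbf{V}$-submodule of $\mathbf{V}^I$ generated by the columns of $F$. For a submodule $M\subseteq \mathbf{V}^I$, $\operatorname{Sat}(M)=\{x\in\mathbf{V}^I\mid\exists a\in\mathbf{V}\setminus\{0\},\ ax\in M\}$. A vector $C=\sum_i c_i e_i$ is primitive if some $c_i$ is a unit; then $\operatorname{piv}(C)$ (the pivot index) is the smallest $i$ such that $c_i$ is a unit, and $\operatorname{cpiv}(C)$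 (the pivot coefficient) is that $c_i$. A matrix with columns $C^1,\dots,C^r$ is in strict $\mathbf{k}$-echelon form if all $C^j$ are primitive, the indices $\operatorname{piv}(C^j)$ are pairwise distinct, and for $j<k$ the coefficient of index $\operatorname{piv}(C^j)$ in $C^k$ is zero. The empty matrix is in strict $\mathbf{k}$-echelon form. For a nonzero vector $a$, $\mathsf{RedPrim}(a)=a/u$, where $u$ is a gcd of the coefficients of $a$, chosen by a fixed rule (for example, $u$ is the coefficient of minimal index among those dividing all the others). Saturation algorithm: start with the empty matrix and treat the columns of $F$ one after the other, from first to last. If the current matrix has columns $C^1,\dots,C^r$ and the new column to be treated is $C=\sum_i c_ie_i$: (1) Gaussian elimination: successively for $j=1,\dots,r$, with $s=\operatorname{piv}(C^j)$ and $c_{j,s}=\operatorname{cpiv}(C^j)$, perform $C\leftarrow C-\frac{c_s}{c_{j,s}}C^j$, where $c_s$ is the coefficient of index $s$ of the current $C$; call $C'$ the final result. (2) If $C'=0$, no column is added. (3) If $C'\neq0$, add $C''=\mathsf{RedPrim}(C')$ as a new last column $C^{r+1}$. The output $G$ is the matrix obtained after all columns of $F$ have been treated. *)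

theory Defs
  imports "Jordan_Normal_Form.VS_Connect"
begin

text \<open>The operation \<open>div\<close> of \<^class>\<open>idom_divide\<close> is exact division: it is uniquely
  determined on pairs \<open>a, b\<close> with \<open>b \<noteq> 0\<close> and \<open>b dvd a\<close>, which are the only pairs on which the
  algorithm below calls it, and every integral domain carries such an operation. The class
  \<^class>\<open>algebraic_semidom\<close> adds no axiom; it only provides the vocabulary of units.\<close>

class valuation_domain = idom_divide + algebraic_semidom +
  assumes dvd_linear: "a dvd b \<or> b dvd a"

text \<open>A matrix with rows indexed by a finite totally ordered set of \<open>n\<close> elements is a \<open>mat\<close> with
  \<open>n\<close> rows, numbered \<open>0, ..., n - 1\<close> in increasing order.\<close>

definition mat_Im :: "'a::comm_ring_1 mat \<Rightarrow> 'a vec set" where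
  "mat_Im F = LinearCombinations.module.span class_ring (module_vec TYPE('a) (dim_row F)) (set (cols F))"

definition Sat :: "nat \<Rightarrow> 'a::comm_ring_1 vec set \<Rightarrow> 'a vec set" where
  "Sat n M = {x \<in> carrier_vec n. \<exists>a. a \<noteq> 0 \<and> a \<cdot>\<^sub>v x \<in> M}"

definition append_cols :: "'a mat \<Rightarrow> 'a mat \<Rightarrow> 'a mat" (infixr \<open>@\<^sub>c\<close> 65) where
  "A @\<^sub>c B = mat_of_cols (dim_row A) (cols A @ cols B)"

definition primitive_vec :: "'a::algebraic_semidom vec \<Rightarrow> bool" where
  "primitive_vec C \<longleftrightarrow> (\<exists>i<dim_vec C. is_unit (C $ i))"

definition piv :: "'a::algebraic_semidom vec \<Rightarrow> nat" where
  "piv C = (LEAST i. i < dim_vec C \<and> is_unit (C $ i))"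

definition cpiv :: "'a::algebraic_semidom vec \<Rightarrow> 'a" where
  "cpiv C = C $ piv C"

definition strict_echelon :: "'a::algebraic_semidom mat \<Rightarrow> bool" where
  "strict_echelon G \<longleftrightarrow>
     (\<forall>j<dim_col G. primitive_vec (col G j)) \<and>
     (\<forall>j<dim_col G. \<forall>k<dim_col G. j \<noteq> k \<longrightarrow> piv (col G j) \<noteq> piv (col G k)) \<and>
     (\<forall>k<dim_col G. \<forall>j<k. col G k $ piv (col G j) = 0)"

definition is_vec_gcd :: "'a::comm_semiring_1 \<Rightarrow> 'a vec \<Rightarrow> bool" where
  "is_vec_gcd u a \<longleftrightarrow> (\<forall>i<dim_vec a. u dvd a $ i) \<and>
     (\<forall>d. (\<forall>i<dim_vec a. d dvd a $ i) \<longrightarrow> d dvd u)"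

text \<open>The algorithm is parametrised by the rule \<open>g\<close> that fixes, for each nonzero vector, one gcd
  of its coefficients.\<close>

definition gcd_rule :: "nat \<Rightarrow> ('a::comm_semiring_1 vec \<Rightarrow> 'a) \<Rightarrow> bool" where
  "gcd_rule n g \<longleftrightarrow> (\<forall>a\<in>carrier_vec n. a \<noteq> 0\<^sub>v n \<longrightarrow> is_vec_gcd (g a) a)"

definition RedPrim :: "('a vec \<Rightarrow> 'a) \<Rightarrow> 'a::idom_divide vec \<Rightarrow> 'a vec" where
  "RedPrim g a = map_vec (\<lambda>c. c div g a) a"

definition elim_step :: "'a::valuation_domain vec \<Rightarrow> 'a vec \<Rightarrow> 'a vec" where
  "elim_step D C = C - (C $ piv D div cpiv D) \<cdot>\<^sub>v D"

definition gauss_elim :: "'a::valuation_domain vec list \<Rightarrow> 'a vec \<Rightarrow> 'a vec" where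
  "gauss_elim Cs C = fold elim_step Cs C"

definition sat_step ::
    "('a vec \<Rightarrow> 'a) \<Rightarrow> 'a::valuation_domain vec list \<Rightarrow> 'a vec \<Rightarrow> 'a vec list" where
  "sat_step g Cs C =
     (let C' = gauss_elim Cs C
      in if C' = 0\<^sub>v (dim_vec C') then Cs else Cs @ [RedPrim g C'])"

definition saturation :: "('a vec \<Rightarrow> 'a) \<Rightarrow> 'a::valuation_domain mat \<Rightarrow> 'a mat" where
  "saturation g F = mat_of_cols (dim_row F) (foldl (sat_step g) [] (cols F))"

text \<open>Gcd rules exist: for instance, take the coefficient of least index among those that divide all
  the others.\<close>

definition first_min_coeff :: "'a::comm_semiring_1 vec \<Rightarrow> 'a" where
  "first_min_coeff a = a $ (LEAST i. i < dim_vec a \<and> (\<forall>j<dim_vec a. a $ i dvd a $ j))"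

lemma ex_min_coeff:
  fixes a :: "'a::valuation_domain vec"
  assumes "0 < m"
  shows "\<exists>i<m. \<forall>j<m. a $ i dvd a $ j"
  using assms
proof (induction m)
  case (Suc m)
  show ?case
  proof (cases "m = 0")
    case False
    with Suc.IH obtain i where i: "i < m" "\<forall>j<m. a $ i dvd a $ j" by auto
    consider "a $ i dvd a $ m" | "a $ m dvd a $ i" using dvd_linear by blast
    then show ?thesis
    proof cases
      case 1
      with i show ?thesis by (metis less_Suc_eq)
    next
      case 2
      with i show ?thesis by (metis dvd_refl dvd_trans less_Suc_eq)
    qed
  qed simp
qed simp

lemma gcd_rule_first_min_coeff:
  "gcd_rule n (first_min_coeff :: 'a::valuation_domain vec \<Rightarrow> 'a)"
  unfolding gcd_rule_def
proof (intro ballI impI)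
  fix a :: "'a vec"
  assume a: "a \<in> carrier_vec n" "a \<noteq> 0\<^sub>v n"
  then have n: "0 < dim_vec a" by (metis carrier_vecD gr0I vec_of_dim_0)
  let ?P = "\<lambda>i. i < dim_vec a \<and> (\<forall>j<dim_vec a. a $ i dvd a $ j)"
  have "?P (LEAST i. ?P i)" using ex_min_coeff[OF n] LeastI_ex[of ?P] by blast
  then show "is_vec_gcd (first_min_coeff a) a"
    by (auto simp: is_vec_gcd_def first_min_coeff_def)
qed

end

theory Submission
  imports Defs
begin

text \<open>A vector in the span of an echelon list that vanishes at all pivots is zero: reading off the
  pivot coordinates from first to last kills the coefficients one by one. Elimination of \<open>x\<close> by an
  echelon list changes \<open>x\<close> only by an element of the span and produces zeros at all pivots, so if
  some nonzero multiple \<open>a x\<close> lies in the span, then so does \<open>a\<close> times the reduced vector, which is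
  therefore zero, and \<open>x\<close> itself is in the span. Hence the span of an echelon list is saturated,
  and the algorithm maintains an echelon list lying between \<open>Im F\<close> and its saturation.\<close>

section \<open>Pivots, primitive reductions and elementary facts about saturation\<close>

lemma piv_less_dim: "primitive_vec C \<Longrightarrow> piv C < dim_vec C"
  and is_unit_cpiv: "primitive_vec C \<Longrightarrow> is_unit (cpiv C)"
  unfolding primitive_vec_def piv_def cpiv_def
  by (metis (mono_tags, lifting) LeastI_ex)+

lemma is_vec_gcd_nonzero:
  assumes "is_vec_gcd u a" "a \<noteq> 0\<^sub>v (dim_vec a)"
  shows "u \<noteq> 0"
  using assms by (auto simp: is_vec_gcd_def)

lemma smult_RedPrim:
  assumes "is_vec_gcd (g a) a"
  shows "g a \<cdot>\<^sub>v RedPrim g a = a"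
  using assms by (intro eq_vecI) (auto simp: RedPrim_def is_vec_gcd_def)

text \<open>By linearity of divisibility, some coefficient \<open>a $ i\<close> divides all the
  others. It is then associated to the gcd \<open>g a\<close>, and its quotient by
  \<open>g a\<close> is a unit.\<close>

lemma primitive_RedPrim:
  fixes a :: "'a::valuation_domain vec"
  assumes gcd: "is_vec_gcd (g a) a" and nz: "a \<noteq> 0\<^sub>v (dim_vec a)"
  shows "primitive_vec (RedPrim g a)"
proof -
  have "0 < dim_vec a" using nz by (metis gr0I vec_of_dim_0)
  then obtain i where i: "i < dim_vec a" "\<forall>j<dim_vec a. a $ i dvd a $ j"
    using ex_min_coeff by blast
  then have "a $ i dvd g a" "g a dvd a $ i" using gcd by (auto simp: is_vec_gcd_def)
  then have "is_unit (a $ i div g a)"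
    using is_vec_gcd_nonzero[OF gcd nz] by (simp add: div_dvd_iff_mult)
  then show ?thesis using i(1) by (auto simp: primitive_vec_def RedPrim_def)
qed

lemma Sat_superset:
  fixes N :: "'a::comm_ring_1 vec set"
  assumes "N \<subseteq> carrier_vec n"
  shows "N \<subseteq> Sat n N"
proof
  fix x assume "x \<in> N"
  then have "1 \<cdot>\<^sub>v x \<in> N" by simp
  then show "x \<in> Sat n N" using \<open>x \<in> N\<close> assms unfolding Sat_def using one_neq_zero by blast
qed

lemma Sat_mono: "N \<subseteq> N' \<Longrightarrow> Sat n N \<subseteq> Sat n N'"
  by (auto simp: Sat_def)

lemma gauss_elim_Cons: "gauss_elim (D # Cs) C = gauss_elim Cs (elim_step D C)"
  by (simp add: gauss_elim_def)

text \<open>A step keeps the list or appends one vector; it never revises an earlier one. This gives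
  both the incrementality of the algorithm and the growth of the span during a run.\<close>

lemma foldl_sat_step_prefix: "\<exists>Ds. foldl (sat_step g) Cs Fs = Cs @ Ds"
proof (induction Fs arbitrary: Cs)
  case (Cons F Fs)
  have "\<exists>Es. sat_step g Cs F = Cs @ Es" by (simp add: sat_step_def Let_def)
  then show ?case using Cons.IH[of "sat_step g Cs F"] by auto
qed simp

section \<open>Submodules and spans, in plain vector operations\<close>

context vec_module
begin

lemma submodule_iff:
  "submodule class_ring N V \<longleftrightarrow> N \<subseteq> carrier_vec n \<and> 0\<^sub>v n \<in> N \<and>
     (\<forall>v\<in>N. \<forall>w\<in>N. v + w \<in> N) \<and> (\<forall>c. \<forall>v\<in>N. c \<cdot>\<^sub>v v \<in> N)"
  using module_axioms unfolding submodule_def by (auto simp: module_vec_simps class_ring_simps)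

lemma span_zero_closed: "S \<subseteq> carrier_vec n \<Longrightarrow> 0\<^sub>v n \<in> span S"
  and span_add_closed: "S \<subseteq> carrier_vec n \<Longrightarrow> v \<in> span S \<Longrightarrow> w \<in> span S \<Longrightarrow> v + w \<in> span S"
  and span_smult_closed: "S \<subseteq> carrier_vec n \<Longrightarrow> v \<in> span S \<Longrightarrow> c \<cdot>\<^sub>v v \<in> span S"
  and span_in_carrier: "S \<subseteq> carrier_vec n \<Longrightarrow> v \<in> span S \<Longrightarrow> v \<in> carrier_vec n"
  using span_is_submodule[of S] unfolding submodule_iff by auto

lemma span_superset: "S \<subseteq> carrier_vec n \<Longrightarrow> v \<in> S \<Longrightarrow> v \<in> span S"
  using in_own_span by blast

lemma span_uminus_closed: "S \<subseteq> carrier_vec n \<Longrightarrow> v \<in> span S \<Longrightarrow> - v \<in> span S"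
proof -
  assume S: "S \<subseteq> carrier_vec n" "v \<in> span S"
  have "- v = (- 1) \<cdot>\<^sub>v v" by (intro eq_vecI) auto
  then show "- v \<in> span S" using span_smult_closed[OF S] by metis
qed

lemma span_diff_closed:
  assumes "S \<subseteq> carrier_vec n" "v \<in> span S" "w \<in> span S"
  shows "v - w \<in> span S"
  using span_add_closed[OF assms(1,2) span_uminus_closed[OF assms(1,3)]]
    span_in_carrier[OF assms(1,2)] span_in_carrier[OF assms(1,3)]
  by (simp add: minus_add_uminus_vec)

text \<open>The sums of a multiple of \<open>u\<close> and an element of \<open>span S\<close> form
  a submodule containing \<open>u\<close> and \<open>S\<close>, so minimality of the span gives the
  decomposition without explicit linear combinations.\<close>

lemma span_insertE:
  assumes S: "insert u S \<subseteq> carrier_vec n" and v: "v \<in> span (insert u S)"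
  obtains c z where "z \<in> span S" "v = c \<cdot>\<^sub>v u + z"
proof -
  let ?N = "{c \<cdot>\<^sub>v u + z | c z. z \<in> span S}"
  have u: "u \<in> carrier_vec n" and S': "S \<subseteq> carrier_vec n" using S by auto
  note closed = span_zero_closed[OF S'] span_add_closed[OF S'] span_smult_closed[OF S']
    span_in_carrier[OF S']
  have "submodule class_ring ?N V"
    unfolding submodule_iff
  proof (intro conjI ballI allI)
    show "?N \<subseteq> carrier_vec n" using u closed by auto
    have "0\<^sub>v n = 0 \<cdot>\<^sub>v u + 0\<^sub>v n" using u by auto
    then show "0\<^sub>v n \<in> ?N" using closed(1) by blast
  next
    fix v w assume "v \<in> ?N" "w \<in> ?N"
    then obtain c z d y where *: "v = c \<cdot>\<^sub>v u + z" "w = d \<cdot>\<^sub>v u + y" "z \<in> span S" "y \<in> span S"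
      by blast
    have "v + w = (c + d) \<cdot>\<^sub>v u + (z + y)"
      using u closed(4)[OF *(3)] closed(4)[OF *(4)] unfolding *(1,2)
      by (intro eq_vecI) (auto simp: algebra_simps)
    then show "v + w \<in> ?N" using closed(2)[OF *(3,4)] by blast
  next
    fix a v assume "v \<in> ?N"
    then obtain c z where *: "v = c \<cdot>\<^sub>v u + z" "z \<in> span S" by blast
    have "a \<cdot>\<^sub>v v = (a * c) \<cdot>\<^sub>v u + a \<cdot>\<^sub>v z"
      using u closed(4)[OF *(2)] unfolding *(1) by (intro eq_vecI) (auto simp: algebra_simps)
    then show "a \<cdot>\<^sub>v v \<in> ?N" using closed(3)[OF *(2)] by blast
  qed
  moreover have "insert u S \<subseteq> ?N"
  proof
    fix x assume "x \<in> insert u S"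
    then consider "x = u" | "x \<in> S" by blast
    then show "x \<in> ?N"
    proof cases
      case 1
      then have "x = 1 \<cdot>\<^sub>v u + 0\<^sub>v n" using u by auto
      then show ?thesis using closed(1) by blast
    next
      case 2
      then have "x = 0 \<cdot>\<^sub>v u + x" using u S' by auto
      then show ?thesis using span_superset[OF S' 2] by blast
    qed
  qed
  ultimately have "span (insert u S) \<subseteq> ?N" by (intro span_is_subset)
  with v that show thesis by blast
qed

text \<open>The vectors that vanish at \<open>i\<close> form a submodule, so a common zero of the
  generators passes to their span.\<close>

lemma span_index_eq_0:
  assumes "S \<subseteq> carrier_vec n" "i < n" "\<And>u. u \<in> S \<Longrightarrow> u $ i = 0" "v \<in> span S"
  shows "v $ i = 0"
proof -
  have "submodule class_ring {v \<in> carrier_vec n. v $ i = 0} V"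
    using assms(2) unfolding submodule_iff by auto
  then have "span S \<subseteq> {v \<in> carrier_vec n. v $ i = 0}"
    using assms(1,3) by (intro span_is_subset) auto
  with assms(4) show ?thesis by auto
qed

lemma mat_Im_eq_span: "dim_row F = n \<Longrightarrow> mat_Im F = span (set (cols F))"
  unfolding mat_Im_def by simp

end

section \<open>Saturation of a submodule\<close>

context idom_vec
begin

text \<open>If \<open>a\<close> and \<open>b\<close> are multipliers for \<open>v\<close> and
  \<open>w\<close>, their product is one for \<open>v + w\<close>, and it is nonzero in a
  domain.\<close>

lemma submodule_Sat:
  assumes "submodule class_ring N V"
  shows "submodule class_ring (Sat n N) V"
  unfolding submodule_iff
proof (intro conjI ballI allI)
  note N = assms[unfolded submodule_iff]
  show "Sat n N \<subseteq> carrier_vec n" by (auto simp: Sat_def)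
  have "1 \<cdot>\<^sub>v 0\<^sub>v n \<in> N" using N by simp
  then show "0\<^sub>v n \<in> Sat n N" unfolding Sat_def using one_neq_zero zero_carrier_vec by blast
next
  note N = assms[unfolded submodule_iff]
  fix v w assume "v \<in> Sat n N" "w \<in> Sat n N"
  then obtain a b where vw: "v \<in> carrier_vec n" "w \<in> carrier_vec n"
    and ab: "a \<noteq> 0" "b \<noteq> 0" "a \<cdot>\<^sub>v v \<in> N" "b \<cdot>\<^sub>v w \<in> N" by (auto simp: Sat_def)
  have "(a * b) \<cdot>\<^sub>v (v + w) = b \<cdot>\<^sub>v (a \<cdot>\<^sub>v v) + a \<cdot>\<^sub>v (b \<cdot>\<^sub>v w)"
    using vw by (intro eq_vecI) (auto simp: algebra_simps)
  also have "\<dots> \<in> N" using N ab by blast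
  finally have "(a * b) \<cdot>\<^sub>v (v + w) \<in> N" .
  moreover have "a * b \<noteq> 0" using ab by simp
  ultimately show "v + w \<in> Sat n N" using vw unfolding Sat_def by blast
next
  note N = assms[unfolded submodule_iff]
  fix c v assume "v \<in> Sat n N"
  then obtain a where v: "v \<in> carrier_vec n" and a: "a \<noteq> 0" "a \<cdot>\<^sub>v v \<in> N" by (auto simp: Sat_def)
  have "a \<cdot>\<^sub>v (c \<cdot>\<^sub>v v) = c \<cdot>\<^sub>v (a \<cdot>\<^sub>v v)"
    using v by (intro eq_vecI) (auto simp: algebra_simps)
  also have "\<dots> \<in> N" using N a by blast
  finally show "c \<cdot>\<^sub>v v \<in> Sat n N" using v a(1) unfolding Sat_def by blast
qed

end

section \<open>Echelon lists and Gaussian elimination\<close>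

locale valuation_vec = idom_vec n f_ty
  for n and f_ty :: "'a::valuation_domain itself"
begin

text \<open>List counterpart of \<open>strict_echelon\<close>, suited to induction: the tail is
  again such a list, and all its vectors vanish at the pivot of the head. That the pivots are
  distinct is derived in \<open>strict_echelon_mat_of_cols\<close>.\<close>

definition echelon_list :: "'a vec list \<Rightarrow> bool" where
  "echelon_list Cs \<longleftrightarrow> set Cs \<subseteq> carrier_vec n \<and> (\<forall>C\<in>set Cs. primitive_vec C) \<and>
     sorted_wrt (\<lambda>D C. C $ piv D = 0) Cs"

lemma echelon_span_eq_0:
  assumes "echelon_list Cs" "v \<in> span (set Cs)" "\<And>D. D \<in> set Cs \<Longrightarrow> v $ piv D = 0"
  shows "v = 0\<^sub>v n"
  using assms
proof (induction Cs arbitrary: v)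
  case Nil
  have "submodule class_ring {0\<^sub>v n} V" unfolding submodule_iff by auto
  then have "span {} \<subseteq> {0\<^sub>v n}" by (intro span_is_subset) auto
  with Nil.prems show ?case by auto
next
  case (Cons D Cs)
  let ?p = "piv D"
  have ech: "echelon_list Cs" and D: "D \<in> carrier_vec n" "primitive_vec D"
    and Cs: "set Cs \<subseteq> carrier_vec n" "\<And>C. C \<in> set Cs \<Longrightarrow> C $ ?p = 0"
    using Cons.prems(1) by (auto simp: echelon_list_def)
  have p: "?p < n" using piv_less_dim[OF D(2)] D(1) by simp
  obtain c z where z: "z \<in> span (set Cs)" and v: "v = c \<cdot>\<^sub>v D + z"
    using span_insertE[of D "set Cs" v] D Cs Cons.prems(2) by (metis insert_subset list.simps(15))
  have zc: "z \<in> carrier_vec n" using span_in_carrier[OF Cs(1) z] .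
  \<comment> \<open>All vectors of the tail vanish at \<open>?p\<close>, hence so does
    \<open>z\<close>, and only \<open>D\<close> contributes to this coordinate.\<close>
  have "c * cpiv D = v $ ?p"
    using span_index_eq_0[OF Cs(1) p Cs(2) z] p D zc unfolding v by (simp add: cpiv_def)
  also have "\<dots> = 0" using Cons.prems(3) by simp
  finally have "c = 0" using is_unit_cpiv[OF D(2)] by auto
  then have "v = z" using v D zc by auto
  then show ?case using Cons.IH[OF ech] z Cons.prems(3) by auto
qed

lemma elim_step_carrier: "D \<in> carrier_vec n \<Longrightarrow> C \<in> carrier_vec n \<Longrightarrow> elim_step D C \<in> carrier_vec n"
  by (simp add: elim_step_def)

lemma gauss_elim_carrier:
  "set Cs \<subseteq> carrier_vec n \<Longrightarrow> C \<in> carrier_vec n \<Longrightarrow> gauss_elim Cs C \<in> carrier_vec n"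
  by (induction Cs arbitrary: C) (auto simp: gauss_elim_Cons elim_step_carrier, simp add: gauss_elim_def)

text \<open>Each step subtracts a multiple of one vector of the list, and the differences
  telescope.\<close>

lemma gauss_elim_diff_in_span:
  assumes "set Cs \<subseteq> carrier_vec n" "C \<in> carrier_vec n"
  shows "C - gauss_elim Cs C \<in> span (set Cs)"
  using assms
proof (induction Cs arbitrary: C)
  case Nil
  then show ?case using span_zero_closed[of "{}"] by (simp add: gauss_elim_def)
next
  case (Cons D Cs)
  let ?S = "set (D # Cs)" and ?E = "elim_step D C"
  have S: "?S \<subseteq> carrier_vec n" and D: "D \<in> carrier_vec n" using Cons.prems by auto
  have E: "?E \<in> carrier_vec n" using elim_step_carrier[OF D Cons.prems(2)] .
  have G: "gauss_elim Cs ?E \<in> carrier_vec n" using gauss_elim_carrier[OF _ E] S by auto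
  have "C - ?E = (C $ piv D div cpiv D) \<cdot>\<^sub>v D"
    using D Cons.prems(2) by (intro eq_vecI) (auto simp: elim_step_def)
  then have 1: "C - ?E \<in> span ?S" using span_smult_closed[OF S span_superset[OF S]] by simp
  have "?E - gauss_elim Cs ?E \<in> span (set Cs)" using Cons.IH[OF _ E] S by auto
  then have 2: "?E - gauss_elim Cs ?E \<in> span ?S" using span_is_monotone[of "set Cs" ?S] by auto
  have "C - gauss_elim (D # Cs) C = (C - ?E) + (?E - gauss_elim Cs ?E)"
    using E G Cons.prems(2) by (intro eq_vecI) (auto simp: gauss_elim_Cons)
  then show ?case using span_add_closed[OF S 1 2] by simp
qed

text \<open>Ensures that a zero created by one elimination step survives the later ones: these
  change \<open>C\<close> only by an element of a span that vanishes at \<open>i\<close>.\<close>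

lemma gauss_elim_index_eq_0:
  fixes C :: "'a vec"
  assumes "set Cs \<subseteq> carrier_vec n" "C \<in> carrier_vec n" "i < n"
    and "\<And>D. D \<in> set Cs \<Longrightarrow> D $ i = 0" "C $ i = 0"
  shows "gauss_elim Cs C $ i = 0"
proof -
  have d: "C - gauss_elim Cs C \<in> span (set Cs)" using gauss_elim_diff_in_span assms by blast
  have "(C - gauss_elim Cs C) $ i = 0" using span_index_eq_0[OF assms(1,3,4) d] .
  then show ?thesis using assms gauss_elim_carrier[OF assms(1,2)] by simp
qed

text \<open>Eliminating with \<open>B\<close> is an exact division by the unit
  \<open>cpiv B\<close>, so it creates a zero at \<open>piv B\<close>. The vectors after
  \<open>B\<close> vanish there and preserve this zero; their own pivots are handled by
  induction.\<close>

lemma gauss_elim_piv_eq_0: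
  assumes "echelon_list Cs" "C \<in> carrier_vec n" "D \<in> set Cs"
  shows "gauss_elim Cs C $ piv D = 0"
  using assms
proof (induction Cs arbitrary: C)
  case (Cons B Cs)
  have ech: "echelon_list Cs" and B: "B \<in> carrier_vec n" "primitive_vec B"
    and Cs: "set Cs \<subseteq> carrier_vec n" "\<And>C. C \<in> set Cs \<Longrightarrow> C $ piv B = 0"
    using Cons.prems(1) by (auto simp: echelon_list_def)
  have p: "piv B < n" using piv_less_dim[OF B(2)] B(1) by simp
  have E: "elim_step B C \<in> carrier_vec n" using elim_step_carrier[OF B(1) Cons.prems(2)] .
  have "elim_step B C $ piv B = C $ piv B - C $ piv B div cpiv B * cpiv B"
    using p B(1) Cons.prems(2) by (simp add: elim_step_def cpiv_def)
  also have "\<dots> = 0" using is_unit_cpiv[OF B(2)] by simp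
  finally have "elim_step B C $ piv B = 0" .
  then have "gauss_elim Cs (elim_step B C) $ piv B = 0"
    using gauss_elim_index_eq_0[OF Cs(1) E p Cs(2)] by blast
  then show ?case using Cons.IH[OF ech E] Cons.prems(3) by (auto simp: gauss_elim_Cons)
qed simp

lemma echelon_span_saturated:
  assumes ech: "echelon_list Cs"
  shows "Sat n (span (set Cs)) = span (set Cs)"
proof
  have Cs: "set Cs \<subseteq> carrier_vec n" using ech by (simp add: echelon_list_def)
  show "span (set Cs) \<subseteq> Sat n (span (set Cs))"
    by (rule Sat_superset[OF span_is_subset2[OF Cs]])
  show "Sat n (span (set Cs)) \<subseteq> span (set Cs)"
  proof
    fix x assume "x \<in> Sat n (span (set Cs))"
    then obtain a where x: "x \<in> carrier_vec n" and a: "a \<noteq> 0" "a \<cdot>\<^sub>v x \<in> span (set Cs)"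
      by (auto simp: Sat_def)
    let ?y = "gauss_elim Cs x"
    have y: "?y \<in> carrier_vec n" using gauss_elim_carrier[OF Cs x] .
    have d: "x - ?y \<in> span (set Cs)" using gauss_elim_diff_in_span[OF Cs x] .
    have "a \<cdot>\<^sub>v ?y = a \<cdot>\<^sub>v x - a \<cdot>\<^sub>v (x - ?y)"
      using x y by (intro eq_vecI) (auto simp: algebra_simps)
    then have "a \<cdot>\<^sub>v ?y \<in> span (set Cs)"
      using span_diff_closed[OF Cs a(2) span_smult_closed[OF Cs d]] by simp
    moreover have "(a \<cdot>\<^sub>v ?y) $ piv D = 0" if "D \<in> set Cs" for D
    proof -
      have "piv D < n" using ech that piv_less_dim[of D] by (force simp: echelon_list_def)
      then show ?thesis using gauss_elim_piv_eq_0[OF ech x that] y by simp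
    qed
    ultimately have ay: "a \<cdot>\<^sub>v ?y = 0\<^sub>v n" by (rule echelon_span_eq_0[OF ech])
    \<comment> \<open>Since \<open>a\<close> times \<open>?y\<close> is zero, \<open>a\<close> can
      be cancelled coordinate by coordinate in the domain.\<close>
    have "?y $ i = 0" if "i < n" for i
      using arg_cong[OF ay, of "\<lambda>v. v $ i"] that y a(1) by simp
    then have "?y = 0\<^sub>v n" using y by (intro eq_vecI) auto
    then show "x \<in> span (set Cs)" using d x by simp
  qed
qed

section \<open>Invariants of the algorithm\<close>

text \<open>The submodule \<open>N\<close> is to be the image of the whole input matrix. Keeping it
  fixed lets the same invariant serve for every column: the list stays inside
  \<open>Sat n N\<close>, while its span absorbs each treated column.\<close>

lemma sat_step_invariant:
  assumes g: "gcd_rule n g"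
    and ech: "echelon_list Cs" and C: "C \<in> carrier_vec n"
    and N: "submodule class_ring N V" "C \<in> N" "set Cs \<subseteq> Sat n N"
  shows "echelon_list (sat_step g Cs C)"
    and "set (sat_step g Cs C) \<subseteq> Sat n N"
    and "C \<in> span (set (sat_step g Cs C))"
proof -
  define C' where "C' = gauss_elim Cs C"
  have Cs: "set Cs \<subseteq> carrier_vec n" using ech by (simp add: echelon_list_def)
  have C': "C' \<in> carrier_vec n" unfolding C'_def by (rule gauss_elim_carrier[OF Cs C])
  have d: "C - C' \<in> span (set Cs)" unfolding C'_def by (rule gauss_elim_diff_in_span[OF Cs C])
  have C_eq: "C = C' + (C - C')" using C C' by (intro eq_vecI) auto
  have "echelon_list (sat_step g Cs C) \<and> set (sat_step g Cs C) \<subseteq> Sat n N \<and>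
    C \<in> span (set (sat_step g Cs C))"
  proof (cases "C' = 0\<^sub>v n")
    case True
    then have "sat_step g Cs C = Cs" using C' by (simp add: sat_step_def C'_def Let_def)
    moreover have "C \<in> span (set Cs)" using True d C by simp
    ultimately show ?thesis using ech N by simp
  next
    case False
    define R where "R = RedPrim g C'"
    have step: "sat_step g Cs C = Cs @ [R]"
      using False C' by (simp add: sat_step_def C'_def R_def Let_def)
    have gcd: "is_vec_gcd (g C') C'" using g C' False by (auto simp: gcd_rule_def)
    have nz: "C' \<noteq> 0\<^sub>v (dim_vec C')" using False C' by simp
    have R: "R \<in> carrier_vec n" "primitive_vec R" "g C' \<cdot>\<^sub>v R = C'"
      using C' primitive_RedPrim[of g C', OF gcd nz] smult_RedPrim[of g C', OF gcd]
      by (auto simp: R_def RedPrim_def)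
    \<comment> \<open>Dividing by the gcd keeps the zeros that elimination has produced at the old
      pivots.\<close>
    have "R $ piv D = 0" if "D \<in> set Cs" for D
    proof -
      have "piv D < n" using ech that piv_less_dim[of D] by (force simp: echelon_list_def)
      then show ?thesis using gauss_elim_piv_eq_0[OF ech C that] C'
        by (simp add: R_def RedPrim_def C'_def)
    qed
    then have 1: "echelon_list (Cs @ [R])"
      using ech R by (auto simp: echelon_list_def sorted_wrt_append)
    have S: "set (Cs @ [R]) \<subseteq> carrier_vec n" using Cs R by simp
    have "C' \<in> span (set (Cs @ [R]))"
      using span_smult_closed[OF S span_superset[OF S], of R "g C'"] R by simp
    moreover have "C - C' \<in> span (set (Cs @ [R]))"
      using d span_is_monotone[of "set Cs" "set (Cs @ [R])"] by auto
    ultimately have 2: "C \<in> span (set (Cs @ [R]))" using span_add_closed[OF S] C_eq by metis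
    note satN = submodule_Sat[OF N(1)]
    \<comment> \<open>\<open>C'\<close> differs from \<open>C\<close> by an element of the span of
      \<open>Cs\<close>; both terms lie in the submodule \<open>Sat n N\<close>, hence so does
      \<open>C'\<close>.\<close>
    have "span (set Cs) \<subseteq> Sat n N" using span_is_subset[OF N(3) satN] .
    then have "- (C - C') \<in> Sat n N" using span_uminus_closed[OF Cs d] by blast
    moreover have "C \<in> Sat n N" using N Sat_superset[of N n] by (auto simp: submodule_iff)
    moreover have "C' = C + - (C - C')" using C C' by (intro eq_vecI) auto
    ultimately have "C' \<in> Sat n N" using satN unfolding submodule_iff by metis
    then obtain b where b: "b \<noteq> 0" "b \<cdot>\<^sub>v C' \<in> N" by (auto simp: Sat_def)
    \<comment> \<open>The gcd divided out of \<open>C'\<close> is absorbed into the multiplier. This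
      is where the result may leave \<open>N\<close> itself.\<close>
    then have "(b * g C') \<cdot>\<^sub>v R \<in> N" using R(3) by (simp add: smult_smult_assoc[symmetric])
    moreover have "b * g C' \<noteq> 0" using b is_vec_gcd_nonzero[OF gcd nz] by simp
    ultimately have "R \<in> Sat n N" using R(1) unfolding Sat_def by blast
    then show ?thesis using 1 2 N step by simp
  qed
  then show "echelon_list (sat_step g Cs C)"
    and "set (sat_step g Cs C) \<subseteq> Sat n N"
    and "C \<in> span (set (sat_step g Cs C))" by auto
qed

lemma foldl_sat_step_invariant:
  assumes g: "gcd_rule n g" and N: "submodule class_ring N V"
    and "echelon_list Cs" "set Cs \<subseteq> Sat n N" "set Fs \<subseteq> N"
  shows "echelon_list (foldl (sat_step g) Cs Fs) \<and> set (foldl (sat_step g) Cs Fs) \<subseteq> Sat n N \<and>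
    set Fs \<subseteq> span (set (foldl (sat_step g) Cs Fs))"
  using assms(3-)
proof (induction Fs arbitrary: Cs)
  case (Cons F Fs)
  let ?Ds = "sat_step g Cs F" and ?G = "foldl (sat_step g) (sat_step g Cs F) Fs"
  have F: "F \<in> N" "F \<in> carrier_vec n" using Cons.prems N by (auto simp: submodule_iff)
  note step = sat_step_invariant[OF g Cons.prems(1) F(2) N F(1) Cons.prems(2)]
  \<comment> \<open>The treated column \<open>F\<close> stays in the span because the remaining
    steps only append vectors.\<close>
  have "set ?Ds \<subseteq> set ?G" using foldl_sat_step_prefix[of g ?Ds Fs] by auto
  then have "F \<in> span (set ?G)" using step(3) span_is_monotone by blast
  then show ?case using Cons.IH[OF step(1,2)] Cons.prems(3) by simp
qed simp

section \<open>From lists of columns back to matrices\<close>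

text \<open>Pivots are distinct because a later vector is zero at an earlier pivot but a unit at its
  own.\<close>

lemma strict_echelon_mat_of_cols:
  assumes ech: "echelon_list Cs"
  shows "strict_echelon (mat_of_cols n Cs)"
proof -
  have car: "Cs ! k \<in> carrier_vec n" and prim: "primitive_vec (Cs ! k)" if "k < length Cs" for k
    using ech that by (auto simp: echelon_list_def)
  have zero: "Cs ! k $ piv (Cs ! j) = 0" if "j < k" "k < length Cs" for j k
    using ech that by (auto simp: echelon_list_def sorted_wrt_iff_nth_less)
  have ne: "piv (Cs ! j) \<noteq> piv (Cs ! k)" if "j < k" "k < length Cs" for j k
    using zero[OF that] is_unit_cpiv[OF prim[OF that(2)]] by (auto simp: cpiv_def)
  have "piv (Cs ! j) \<noteq> piv (Cs ! k)" if "j < length Cs" "k < length Cs" "j \<noteq> k" for j k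
    using ne[of j k] ne[of k j] that by (cases j k rule: linorder_cases) auto
  then show ?thesis using car prim zero by (auto simp: strict_echelon_def)
qed

text \<open>The invariant is used with the image of \<open>F\<close> as \<open>N\<close>. It puts
  \<open>Cs\<close> inside the saturation, which is a submodule, and the columns of \<open>F\<close>
  inside the span of \<open>Cs\<close>. Monotonicity of \<open>Sat\<close>, together with the fact
  that this span is already saturated, gives the reverse inclusion.\<close>

lemma foldl_sat_step_cols:
  fixes g :: "'a vec \<Rightarrow> 'a"
  assumes g: "gcd_rule n g" and F: "F \<in> carrier_mat n m"
  defines "Cs \<equiv> foldl (sat_step g) [] (cols F)"
  shows "echelon_list Cs" and "span (set Cs) = Sat n (span (set (cols F)))"
proof -
  have S: "set (cols F) \<subseteq> carrier_vec n" using F cols_dim by blast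
  note N = span_is_submodule[OF S]
  have inv: "echelon_list Cs" "set Cs \<subseteq> Sat n (span (set (cols F)))" 
      "set (cols F) \<subseteq> span (set Cs)"
    using foldl_sat_step_invariant[OF g N, of "[]" "cols F"] in_own_span[OF S]
    by (auto simp: Cs_def echelon_list_def)
  have Cs: "set Cs \<subseteq> carrier_vec n" using inv by (simp add: echelon_list_def)
  show "echelon_list Cs" by fact
  show "span (set Cs) = Sat n (span (set (cols F)))"
  proof
    show "span (set Cs) \<subseteq> Sat n (span (set (cols F)))"
      using span_is_subset[OF inv(2) submodule_Sat[OF N]] .
    have "span (set (cols F)) \<subseteq> span (set Cs)"
      using span_is_subset[OF inv(3) span_is_submodule[OF Cs]] .
    then show "Sat n (span (set (cols F))) \<subseteq> span (set Cs)"
      using Sat_mono echelon_span_saturated[OF inv(1)] by blast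
  qed
qed

lemma saturation_correct:
  fixes g :: "'a vec \<Rightarrow> 'a"
  assumes g: "gcd_rule n g" and F: "F \<in> carrier_mat n m"
  shows "\<exists>r. saturation g F \<in> carrier_mat n r"
    and "strict_echelon (saturation g F)"
    and "mat_Im (saturation g F) = Sat n (mat_Im F)"
proof -
  define Cs where "Cs = foldl (sat_step g) [] (cols F)"
  have sat: "saturation g F = mat_of_cols n Cs" using F by (simp add: saturation_def Cs_def)
  note Cs = foldl_sat_step_cols[OF g F, folded Cs_def]
  have "cols (mat_of_cols n Cs) = Cs" using Cs(1) by (intro cols_mat_of_cols) (simp add: echelon_list_def)
  then show "mat_Im (saturation g F) = Sat n (mat_Im F)"
    using Cs(2) F by (simp add: sat mat_Im_eq_span)
  show "strict_echelon (saturation g F)"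
    using strict_echelon_mat_of_cols[OF Cs(1)] by (simp add: sat)
  show "\<exists>r. saturation g F \<in> carrier_mat n r"
    unfolding sat using mat_of_cols_carrier(1) by blast
qed

lemma saturation_append_cols:
  fixes g :: "'a vec \<Rightarrow> 'a"
  assumes g: "gcd_rule n g" and F1: "F1 \<in> carrier_mat n m1" and F2: "F2 \<in> carrier_mat n m2"
  shows "\<exists>r2. \<exists>G2 \<in> carrier_mat n r2. saturation g (F1 @\<^sub>c F2) = saturation g F1 @\<^sub>c G2"
proof -
  have S: "set (cols F1 @ cols F2) \<subseteq> carrier_vec n" using F1 F2 cols_dim[of F1] cols_dim[of F2] by auto
  then have cols: "cols (F1 @\<^sub>c F2) = cols F1 @ cols F2"
    using F1 by (simp add: append_cols_def)
  have F: "F1 @\<^sub>c F2 \<in> carrier_mat n (m1 + m2)" using F1 F2 by (auto simp: append_cols_def)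
  let ?C1 = "foldl (sat_step g) [] (cols F1)"
  obtain Ds where Ds: "foldl (sat_step g) ?C1 (cols F2) = ?C1 @ Ds"
    using foldl_sat_step_prefix by blast
  \<comment> \<open>Correct dimensions are needed for \<open>cols\<close> to recover
    \<open>?C1\<close> and \<open>Ds\<close> from the matrices built on them.\<close>
  have "set (?C1 @ Ds) \<subseteq> carrier_vec n"
    using foldl_sat_step_cols(1)[OF g F] Ds by (simp add: cols echelon_list_def)
  then have "saturation g (F1 @\<^sub>c F2) = saturation g F1 @\<^sub>c mat_of_cols n Ds"
    using F1 F Ds unfolding saturation_def cols by (simp add: append_cols_def)
  then show ?thesis by (intro exI[of _ "length Ds"] bexI) auto
qed

end

theorem theorem1p5:
  fixes n :: nat and g :: "'a::valuation_domain vec \<Rightarrow> 'a"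
  assumes "gcd_rule n g"
  shows "(\<forall>m. \<forall>F \<in> carrier_mat n m.
            \<exists>r. saturation g F \<in> carrier_mat n r
              \<and> strict_echelon (saturation g F)
              \<and> mat_Im (saturation g F) = Sat n (mat_Im F))
       \<and> (\<forall>m1 m2. \<forall>F1 \<in> carrier_mat n m1. \<forall>F2 \<in> carrier_mat n m2.
            \<exists>r2. \<exists>G2 \<in> carrier_mat n r2.
              saturation g (F1 @\<^sub>c F2) = saturation g F1 @\<^sub>c G2)"
proof -
  interpret valuation_vec n "TYPE('a)" .
  show ?thesis using saturation_correct[OF assms] saturation_append_cols[OF assms] by blast
qed

end
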